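(* Let $R$ be a commutative ring with identity such that for each maximal ideal $\mathcal{M}$, $\mathcal{M}^i\neq\mathcal{M}^{i+1}$ for all $i\ge0$ and $\bigcap_{i\geq 0}\mathcal{M}^i=(0)$. Let $\mathcal{F}$ be a finite set of maximal ideals of $R$ and let $\mathit{M}(\mathcal{F})$ be the multiplicative monoid of ideals generated by $\mathcal{F}$. Let $\mathcal{I}=\mathcal{M}_1^{t_1}\cdots\mathcal{M}_k^{t_k}\in\mathit{M}(\mathcal{F})$. Then $$\mathcal{I}\setminus\Big(\bigcup_{\mathcal{J}\in\mathit{M}(\mathcal{F})^*}\mathcal{I}\mathcal{J}\Big)\neq\emptyset,$$ where $\mathit{M}(\mathcal{F})^*=\mathit{M}(\mathcal{F})\setminus\{R\}$.
   Context: $\mathit{M}(\mathcal{F})$ consists of all finite products of ideals in $\mathcal{F}$, with $R$ as the empty product. *)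

theory Defs
  imports "HOL-Algebra.Ideal_Product"
begin

text \<open>Elements are finite products (as ideals, with repetition allowed) of members of
  \<open>F\<close>; the empty list gives \<open>carrier R\<close>.\<close>

definition ideal_monoid :: "('a, 'b) ring_scheme \<Rightarrow> 'a set set \<Rightarrow> 'a set set" where
  "ideal_monoid R F = {foldr (ideal_prod R) Is (carrier R) | Is. set Is \<subseteq> F}"

definition ideal_monoid_star :: "('a, 'b) ring_scheme \<Rightarrow> 'a set set \<Rightarrow> 'a set set" where
  "ideal_monoid_star R F = ideal_monoid R F - {carrier R}"

end

theory Submission
  imports Defs
begin

text \<open>Every product \<open>I \<cdot> J\<close> with \<open>J \<noteq> R\<close> lies in some \<open>I \<cdot> M\<close> with \<open>M \<in> F\<close>, so an element of \<open>I\<close>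
  outside all of the \<open>I \<cdot> M\<close> is needed. First \<open>I \<noteq> I \<cdot> M\<close>: writing \<open>I = M\<^sup>t \<cdot> K\<close> with \<open>K\<close> not inside
  \<open>M\<close>, equality would give \<open>M\<^sup>t = M\<^sup>t \<cdot> K + M\<^sup>t \<cdot> M \<subseteq> M\<^sup>t \<cdot> M\<close>, as \<open>K + M = R\<close>. Then the members of \<open>F\<close>
  are treated one at a time, as in prime avoidance: an element \<open>x\<close> good for the previous ideals is
  corrected by \<open>a q \<notin> I \<cdot> M\<close>, where \<open>a \<in> I\<close> and \<open>q\<close> lies in all the previous ideals but not in \<open>M\<close>.\<close>

lemma ideal_prod_mono:
  assumes "A \<subseteq> A'" "B \<subseteq> B'"
  shows "ideal_prod R A B \<subseteq> ideal_prod R A' B'"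
proof
  fix x assume "x \<in> ideal_prod R A B"
  then show "x \<in> ideal_prod R A' B'"
    by induction (use assms in \<open>auto intro: ideal_prod.intros\<close>)
qed

lemma ideals_set_simps:
  "\<one>\<^bsub>ideals_set R\<^esub> = carrier R"
  "A \<otimes>\<^bsub>ideals_set R\<^esub> B = ideal_prod R A B"
  by (simp_all add: ideals_set_def)

context cring
begin

lemma ideals_set_pow_ideal:
  assumes "ideal M R"
  shows "ideal (M [^]\<^bsub>ideals_set R\<^esub> (n::nat)) R"
  by (induction n)
    (simp_all add: ideals_set_simps oneideal ideal_prod_is_ideal assms)

lemma foldr_ideal_prod_ideal:
  assumes "\<And>N. N \<in> set Is \<Longrightarrow> ideal N R"
  shows "ideal (foldr (ideal_prod R) Is (carrier R)) R"
  using assms by (induction Is) (auto simp: oneideal intro: ideal_prod_is_ideal)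

text \<open>The ideal \<open>M <+> PIdl q\<close> contains \<open>M\<close> strictly because of
  \<open>q\<close>, so maximality makes it the whole ring and \<one> splits accordingly.\<close>

lemma maximalideal_not_mem_coprime:
  assumes M: "maximalideal M R" and q: "q \<in> carrier R" "q \<notin> M"
  obtains m r where "m \<in> M" "r \<in> carrier R" "\<one> = m \<oplus> q \<otimes> r"
proof -
  interpret M: maximalideal M R by fact
  have P: "ideal (PIdl q) R" by (rule cgenideal_ideal[OF q(1)])
  have sub: "M \<union> PIdl q \<subseteq> M <+> PIdl q"
    using union_genideal[OF M.is_ideal P] genideal_self[of "M \<union> PIdl q"]
      M.a_subset additive_subgroup.a_subset[OF ideal.axioms(1)[OF P]] by auto
  have idl: "ideal (M <+> PIdl q) R" by (rule add_ideals[OF M.is_ideal P])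
  have "M <+> PIdl q \<noteq> M" using sub cgenideal_self[OF q(1)] q(2) by auto
  then have "M <+> PIdl q = carrier R"
    using M.I_maximal[OF idl] sub additive_subgroup.a_subset[OF ideal.axioms(1)[OF idl]] by auto
  then have "\<one> \<in> M <+> PIdl q" by simp
  then obtain m p where "m \<in> M" "p \<in> PIdl q" "\<one> = m \<oplus> p"
    unfolding set_add_def' by auto
  moreover from this obtain r where "r \<in> carrier R" "p = r \<otimes> q"
    unfolding cgenideal_def by auto
  ultimately show thesis using that q(1) m_comm by auto
qed

text \<open>An element outside \<open>M\<close> is invertible modulo \<open>M\<close>: multiply
  \<open>a\<close> by \<one> = \<open>m\<close> \<oplus> \<open>q\<close> \<otimes> \<open>r\<close>
  and both summands fall into \<open>A\<close> \<cdot> \<open>M\<close>. This lets such a factor be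
  cancelled, and read contrapositively it supplies an element \<open>a\<close> with \<open>a\<close>
  \<otimes> \<open>q\<close> outside \<open>A\<close> \<cdot> \<open>M\<close>.\<close>

lemma ideal_subset_prod_maximalideal:
  assumes M: "maximalideal M R" and A: "ideal A R" and q: "q \<in> carrier R" "q \<notin> M"
    and prod: "\<And>a. a \<in> A \<Longrightarrow> a \<otimes> q \<in> A \<cdot> M"
  shows "A \<subseteq> A \<cdot> M"
proof
  fix a assume a: "a \<in> A"
  interpret M: maximalideal M R by fact
  interpret AM: ideal "A \<cdot> M" R by (rule ideal_prod_is_ideal[OF A M.is_ideal])
  obtain m r where mr: "m \<in> M" "r \<in> carrier R" "\<one> = m \<oplus> q \<otimes> r"
    using maximalideal_not_mem_coprime[OF M q] .
  have ac: "a \<in> carrier R" by (rule ideal.Icarr[OF A a])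
  have "a = a \<otimes> (m \<oplus> q \<otimes> r)" using mr(3)[symmetric] ac by simp
  also have "\<dots> = a \<otimes> m \<oplus> (a \<otimes> q) \<otimes> r"
    using ac mr q M.Icarr by (simp add: r_distr m_assoc)
  also have "\<dots> \<in> A \<cdot> M"
    using AM.a_closed ideal_prod.prod[OF a mr(1)] AM.I_r_closed[OF prod[OF a] mr(2)] by blast
  finally show "a \<in> A \<cdot> M" .
qed

text \<open>The exponent \<open>t\<close> is the multiplicity of \<open>M\<close> in the list, and \<open>k\<close> stands in for the product of
  the remaining factors.\<close>

lemma foldr_ideal_prod_power_part:
  assumes M: "maximalideal M R" and "\<And>N. N \<in> set Is \<Longrightarrow> maximalideal N R"
  shows "\<exists>t::nat. foldr (ideal_prod R) Is (carrier R) \<subseteq> M [^]\<^bsub>ideals_set R\<^esub> t \<and>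
    (\<exists>k \<in> carrier R - M. \<forall>a \<in> M [^]\<^bsub>ideals_set R\<^esub> t. a \<otimes> k \<in> foldr (ideal_prod R) Is (carrier R))"
  using assms(2)
proof (induction Is)
  case Nil
  interpret M: maximalideal M R by fact
  \<comment> \<open>The empty product is the zeroth power of \<open>M\<close>, with \<open>k\<close>
    = \<one>.\<close>
  have "\<one> \<notin> M" using M.I_notcarr M.one_imp_carrier by auto
  then show ?case
    by (intro exI[of _ 0]) (auto simp: ideals_set_simps intro!: bexI[of _ \<one>])
next
  case (Cons N Is)
  let ?I = "foldr (ideal_prod R) Is (carrier R)"
  interpret M: maximalideal M R by fact
  interpret N: maximalideal N R using Cons.prems by simp
  have I: "ideal ?I R"
    using Cons.prems by (auto intro!: foldr_ideal_prod_ideal intro: maximalideal.axioms(1))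
  obtain t :: nat and k where t: "?I \<subseteq> M [^]\<^bsub>ideals_set R\<^esub> t" and k: "k \<in> carrier R" "k \<notin> M"
    and ak: "\<And>a. a \<in> M [^]\<^bsub>ideals_set R\<^esub> t \<Longrightarrow> a \<otimes> k \<in> ?I"
    using Cons.IH Cons.prems by auto
  interpret Mt: ideal "M [^]\<^bsub>ideals_set R\<^esub> t" R by (rule ideals_set_pow_ideal[OF M.is_ideal])
  show ?case
  proof (cases "N = M")
    case True
    \<comment> \<open>A further factor \<open>M\<close> raises the exponent by one and keeps
      \<open>k\<close>. Elements of a product ideal are sums of products, hence the
      induction.\<close>
    have "a \<otimes> k \<in> M \<cdot> ?I" if "a \<in> (M [^]\<^bsub>ideals_set R\<^esub> t) \<cdot> M" for a
      using that
    proof (induction rule: ideal_prod.induct)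
      case (prod b m)
      then have "b \<otimes> m \<otimes> k = m \<otimes> (b \<otimes> k)"
        using k Mt.Icarr M.Icarr by (simp add: m_comm m_assoc m_lcomm)
      then show ?case using ideal_prod.prod[OF prod(2) ak[OF prod(1)]] by simp
    next
      case (sum s1 s2)
      then have "s1 \<in> carrier R" "s2 \<in> carrier R"
        using ideal_prod_in_carrier[OF Mt.is_ideal M.is_ideal] by auto
      then show ?case using sum k by (simp add: l_distr ideal_prod.sum)
    qed
    moreover have "M \<cdot> ?I \<subseteq> (M [^]\<^bsub>ideals_set R\<^esub> t) \<cdot> M"
      using ideal_prod_mono[OF t order_refl] ideal_prod_commute[OF M.is_ideal I] by auto
    ultimately show ?thesis
      using k True by (intro exI[of _ "Suc t"]) (auto simp: ideals_set_simps)
  next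
    case False
    \<comment> \<open>Distinct maximal ideals are incomparable. A factor other than \<open>M\<close>
      leaves \<open>t\<close> alone and multiplies \<open>k\<close> by some \<open>n\<close> in
      \<open>N\<close> outside \<open>M\<close>; since \<open>M\<close> is prime, the new
      \<open>k\<close> stays outside \<open>M\<close>.\<close>
    then have "\<not> N \<subseteq> M"
      using N.I_maximal[OF M.is_ideal] M.a_subset M.I_notcarr by auto
    then obtain n where n: "n \<in> N" "n \<notin> M" by auto
    have "n \<otimes> k \<notin> M"
      using primeideal.I_prime[OF maximalideal_prime[OF M]] n k N.Icarr by blast
    moreover have "a \<otimes> (n \<otimes> k) \<in> N \<cdot> ?I" if "a \<in> M [^]\<^bsub>ideals_set R\<^esub> t" for a
    proof -
      have "a \<otimes> (n \<otimes> k) = n \<otimes> (a \<otimes> k)"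
        using k n N.Icarr Mt.Icarr[OF that] by (simp add: m_lcomm)
      then show ?thesis using ideal_prod.prod[OF n(1) ak[OF that]] by simp
    qed
    moreover have "N \<cdot> ?I \<subseteq> M [^]\<^bsub>ideals_set R\<^esub> t"
      using ideal_prod_inter[OF N.is_ideal I] t by auto
    ultimately show ?thesis
      using k n N.Icarr by (intro exI[of _ t]) (auto intro!: bexI[of _ "n \<otimes> k"])
  qed
qed

lemma foldr_ideal_prod_not_subset:
  assumes M: "maximalideal M R" and Is: "\<And>N. N \<in> set Is \<Longrightarrow> maximalideal N R"
    and pow: "\<And>i::nat. M [^]\<^bsub>ideals_set R\<^esub> i \<noteq> M [^]\<^bsub>ideals_set R\<^esub> Suc i"
  shows "\<not> foldr (ideal_prod R) Is (carrier R) \<subseteq> foldr (ideal_prod R) Is (carrier R) \<cdot> M"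
    (is "\<not> ?I \<subseteq> _")
proof
  assume sub: "?I \<subseteq> ?I \<cdot> M"
  interpret M: maximalideal M R by fact
  obtain t :: nat and k where t: "?I \<subseteq> M [^]\<^bsub>ideals_set R\<^esub> t" and k: "k \<in> carrier R" "k \<notin> M"
    and ak: "\<And>a. a \<in> M [^]\<^bsub>ideals_set R\<^esub> t \<Longrightarrow> a \<otimes> k \<in> ?I"
    using foldr_ideal_prod_power_part[OF M, of Is] Is by auto
  have Mt: "ideal (M [^]\<^bsub>ideals_set R\<^esub> t) R" by (rule ideals_set_pow_ideal[OF M.is_ideal])
  \<comment> \<open>For \<open>a\<close> in the power of \<open>M\<close>, \<open>a\<close>
    \<otimes> \<open>k\<close> lies in the product \<open>?I\<close>, hence in \<open>?I\<close>
    \<cdot> \<open>M\<close>, hence in the next power of \<open>M\<close>; now \<open>k\<close> can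
    be cancelled.\<close>
  have "M [^]\<^bsub>ideals_set R\<^esub> t \<subseteq> (M [^]\<^bsub>ideals_set R\<^esub> t) \<cdot> M"
    using ideal_subset_prod_maximalideal[OF M Mt k] ak sub ideal_prod_mono[OF t order_refl]
    by blast
  then show False
    using pow[of t] ideal_prod_inter[OF Mt M.is_ideal] by (auto simp: ideals_set_simps)
qed

text \<open>Choose in each member of \<open>F\<close> an element outside \<open>M\<close> and
  multiply them all: primality of \<open>M\<close> keeps the product outside
  \<open>M\<close>.\<close>

lemma maximalideals_separating_element:
  assumes "finite F" and "\<And>N. N \<in> F \<Longrightarrow> maximalideal N R"
    and M: "maximalideal M R" "M \<notin> F"
  obtains q where "q \<in> carrier R" "q \<notin> M" "\<And>N. N \<in> F \<Longrightarrow> q \<in> N"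
proof -
  interpret M: maximalideal M R by fact
  have "\<exists>q \<in> carrier R - M. \<forall>N \<in> F. q \<in> N"
    using assms(1,2) M(2)
  proof (induction F rule: finite_induct)
    case empty
    then show ?case using M.I_notcarr M.a_subset by auto
  next
    case (insert N F)
    then obtain q where q: "q \<in> carrier R" "q \<notin> M" "\<forall>N \<in> F. q \<in> N" by auto
    interpret N: maximalideal N R using insert.prems by simp
    have "\<not> N \<subseteq> M"
      using N.I_maximal[OF M.is_ideal] M.a_subset M.I_notcarr insert.prems by auto
    then obtain n where n: "n \<in> N" "n \<notin> M" by auto
    have "n \<otimes> q \<notin> M"
      using primeideal.I_prime[OF maximalideal_prime[OF M(1)]] n q N.Icarr by blast
    moreover have "n \<otimes> q \<in> N'" if "N' \<in> F" for N'
      using that insert.prems q n N.Icarr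
      by (auto intro!: ideal.I_l_closed maximalideal.axioms(1))
    ultimately show ?case
      using N.I_r_closed[OF n(1) q(1)] n q N.Icarr by (intro bexI[of _ "n \<otimes> q"]) auto
  qed
  then show thesis using that by auto
qed

lemma ideal_maximalideals_avoidance:
  assumes I: "ideal I R" and "finite F" and "\<And>M. M \<in> F \<Longrightarrow> maximalideal M R"
    and "\<And>M. M \<in> F \<Longrightarrow> \<not> I \<subseteq> I \<cdot> M"
  shows "\<exists>x \<in> I. \<forall>M \<in> F. x \<notin> I \<cdot> M"
  using assms(2-)
proof (induction F rule: finite_induct)
  case empty
  then show ?case
    using additive_subgroup.zero_closed[OF ideal.axioms(1)[OF I]] by auto
next
  case (insert M F)
  then obtain x where x: "x \<in> I" "\<And>N. N \<in> F \<Longrightarrow> x \<notin> I \<cdot> N" by auto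
  show ?case
  proof (cases "x \<in> I \<cdot> M")
    case False
    then show ?thesis using x by auto
  next
    case True
    interpret I: ideal I R by fact
    have M: "maximalideal M R" using insert.prems by simp
    have prod_ideal: "ideal (I \<cdot> N) R" if "N \<in> insert M F" for N
      using that insert.prems by (auto intro!: ideal_prod_is_ideal[OF I] intro: maximalideal.axioms(1))
    obtain q where q: "q \<in> carrier R" "q \<notin> M" "\<And>N. N \<in> F \<Longrightarrow> q \<in> N"
      using maximalideals_separating_element[OF insert.hyps(1) _ M insert.hyps(2)] insert.prems
      by auto
    \<comment> \<open>If no such \<open>a\<close> existed, \<open>q\<close> could be cancelled
      modulo \<open>M\<close>, giving \<open>I\<close> \<subseteq> \<open>I\<close> \<cdot>
      \<open>M\<close>.\<close>
    obtain a where a: "a \<in> I" "a \<otimes> q \<notin> I \<cdot> M"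
      using ideal_subset_prod_maximalideal[OF M I q(1,2)] insert.prems by blast
    have aq: "a \<otimes> q \<in> I" using I.I_r_closed a q by auto
    have cancel: "v \<in> I \<cdot> N"
      if N: "N \<in> insert M F" and u: "u \<in> I \<cdot> N" and v: "v \<in> carrier R" and uv: "u \<oplus> v \<in> I \<cdot> N"
      for N u v
    proof -
      interpret IN: ideal "I \<cdot> N" R using prod_ideal[OF N] .
      have "v = \<ominus> u \<oplus> (u \<oplus> v)" using IN.Icarr[OF u] v by (simp add: r_neg1)
      then show ?thesis using IN.a_closed[OF IN.a_inv_closed[OF u] uv] by simp
    qed
    have carr: "x \<in> carrier R" "a \<otimes> q \<in> carrier R" using x aq I.Icarr by auto
    \<comment> \<open>Modulo \<open>I\<close> \<cdot> \<open>M\<close> the term \<open>x\<close>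
      vanishes and \<open>a\<close> \<otimes> \<open>q\<close> does not; modulo each earlier
      \<open>I\<close> \<cdot> \<open>N\<close> the roles are reversed, since \<open>q\<close> lies
      in \<open>N\<close>.\<close>
    have "x \<oplus> a \<otimes> q \<notin> I \<cdot> M" using cancel[of M x "a \<otimes> q"] True carr a by auto
    moreover have "x \<oplus> a \<otimes> q \<notin> I \<cdot> N" if "N \<in> F" for N
      using cancel[of N "a \<otimes> q" x] that carr x(2)[OF that] ideal_prod.prod[OF a(1) q(3)[OF that]]
      by (auto simp: a_comm)
    ultimately show ?thesis using I.a_closed[OF x(1) aq] by auto
  qed
qed

text \<open>A product different from the ring has at least one factor, and it is contained in its
  first one.\<close>

lemma ideal_monoid_star_subset:
  assumes "\<And>M. M \<in> F \<Longrightarrow> ideal M R" and "J \<in> ideal_monoid_star R F"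
  obtains M where "M \<in> F" "J \<subseteq> M"
proof -
  obtain Js where Js: "J = foldr (ideal_prod R) Js (carrier R)" "set Js \<subseteq> F" "J \<noteq> carrier R"
    using assms(2) unfolding ideal_monoid_star_def ideal_monoid_def by auto
  then obtain M Ks where "Js = M # Ks" by (cases Js) auto
  moreover from this have "ideal (foldr (ideal_prod R) Ks (carrier R)) R"
    using Js assms(1) by (auto intro!: foldr_ideal_prod_ideal)
  ultimately have "M \<in> F" "J \<subseteq> M"
    using Js assms(1) ideal_prod_inter[of M "foldr (ideal_prod R) Ks (carrier R)"] by auto
  then show thesis by (rule that)
qed

end

theorem mainTheorem8:
  fixes R :: "('a, 'b) ring_scheme" (structure)
    and F :: "'a set set" and I :: "'a set"
  assumes "cring R"
    and "\<And>M (i::nat). maximalideal M R \<Longrightarrow>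
           M [^]\<^bsub>ideals_set R\<^esub> i \<noteq> M [^]\<^bsub>ideals_set R\<^esub> Suc i"
    and "\<And>M. maximalideal M R \<Longrightarrow> (\<Inter>i::nat. M [^]\<^bsub>ideals_set R\<^esub> i) = {\<zero>}"
    and "finite F" and "\<And>M. M \<in> F \<Longrightarrow> maximalideal M R"
    and "I \<in> ideal_monoid R F"
  shows "I - (\<Union>J \<in> ideal_monoid_star R F. I \<cdot> J) \<noteq> {}"
proof -
  interpret cring R by fact
  obtain Is where Is: "I = foldr (ideal_prod R) Is (carrier R)" "set Is \<subseteq> F"
    using assms(6) unfolding ideal_monoid_def by auto
  have F_ideal: "ideal M R" if "M \<in> F" for M
    using assms(5)[OF that] by (rule maximalideal.axioms(1))
  have I: "ideal I R"
    unfolding Is(1) using Is(2) F_ideal by (auto intro!: foldr_ideal_prod_ideal)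
  have "\<not> I \<subseteq> I \<cdot> M" if "M \<in> F" for M
    unfolding Is(1)
    by (rule foldr_ideal_prod_not_subset) (use that Is(2) assms(2,5) in auto)
  then obtain x where x: "x \<in> I" "\<And>M. M \<in> F \<Longrightarrow> x \<notin> I \<cdot> M"
    using ideal_maximalideals_avoidance[OF I assms(4,5)] by auto
  have "x \<notin> I \<cdot> J" if J: "J \<in> ideal_monoid_star R F" for J
  proof -
    obtain M where "M \<in> F" "J \<subseteq> M" using ideal_monoid_star_subset[OF F_ideal J] .
    then show ?thesis using x(2) ideal_prod_mono[OF order_refl] by blast
  qed
  then show ?thesis using x(1) by auto
qed

end
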